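(* For every integer $n \ge 3$, $$\frac{n!!}{(n-1)!!} = \frac{1}{\left(\frac{(n-1)!!}{(n-2)!!}\right)} + \frac{(n-2)!!}{(n-3)!!}.$$
   Context: Here $m!!$ denotes the double factorial: $(2m)!! = (2m)(2m-2)\cdots 2$, $(2m+1)!! = (2m+1)(2m-1)\cdots 1$, and $0!! = 1$. *)

theory Defs
  imports Complex_Main
begin

fun double_fact :: "nat \<Rightarrow> nat" where
  "double_fact 0 = 1"
| "double_fact (Suc 0) = 1"
| "double_fact (Suc (Suc n)) = Suc (Suc n) * double_fact n"

lemma double_fact_even: "double_fact (2 * m) = (\<Prod>k=1..m. 2 * k)"
  by (induction m) simp_all

lemma double_fact_odd: "double_fact (2 * m + 1) = (\<Prod>k=0..m. 2 * k + 1)"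
  by (induction m) simp_all

end

theory Submission
  imports Defs
begin

text \<open>With n = m + 3, the recursion writes all four double factorials through a = m!! and b =
  (m+1)!!. The right side is then b/((m+2)a) + b/a = (m+3)b/((m+2)a), which is the left side; the
  quotients make sense because double factorials are positive.\<close>

lemma double_fact_pos: "double_fact n > 0"
  by (induction n rule: double_fact.induct) simp_all

theorem corollary2p1:
  fixes n :: nat
  assumes "n \<ge> 3"
  shows "real (double_fact n) / real (double_fact (n - 1)) =
    1 / (real (double_fact (n - 1)) / real (double_fact (n - 2)))
    + real (double_fact (n - 2)) / real (double_fact (n - 3))"
proof -
  \<comment> \<open>Subtraction truncates on \<open>nat\<close>; \<open>n \<ge> 3\<close> ensures
    that \<open>m\<close> recovers \<open>n\<close> as \<open>m + 3\<close>.\<close>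
  define m where "m = n - 3"
  have n: "n = Suc (Suc (Suc m))"
    using assms by (simp add: m_def)
  define a b where "a = real (double_fact m)" and "b = real (double_fact (Suc m))"
  have "a > 0" "b > 0"
    by (simp_all add: a_def b_def double_fact_pos)
  have *: "real (double_fact (Suc (Suc m))) = (real m + 2) * a"
    "real (double_fact (Suc (Suc (Suc m)))) = (real m + 3) * b"
    by (simp_all add: a_def b_def algebra_simps)
  \<comment> \<open>Clearing the nonzero denominators leaves 1 + (m + 2) = m + 3.\<close>
  have "(real m + 3) * b / ((real m + 2) * a) = 1 / ((real m + 2) * a / b) + b / a"
    using \<open>a > 0\<close> \<open>b > 0\<close> by (simp add: divide_simps) (simp add: algebra_simps)
  moreover have "n - 1 = Suc (Suc m)" "n - 2 = Suc m" "n - 3 = m"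
    by (simp_all add: n)
  ultimately show ?thesis
    unfolding n by (simp only: * a_def b_def diff_Suc_1)
qed

end
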